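(* Let $t_1$, $t_2$ and $E$ be terms and $a$ a term variable. If $t_1\equiv t_2$ then $E[a:=t_1]\equiv E[a:=t_2]$.
   Context: Fix pairwise disjoint countably infinite sets of $\lambda$-variables ($x,y,\dots$), stack variables ($\alpha,\beta,\dots$), term variables ($a,b,\dots$), and countable sets of labels $l$ and constructors $C$. Values, terms, stacks, processes: $v,w::=x\mid\lambda x\,t\mid C[v]\mid\{l_i=v_i\}_{i\in I}$; $t,u::=a\mid v\mid t\,u\mid\mu\alpha\,t\mid p\mid v.l\mid\mathrm{case}_v[C_i[x_i]\to t_i]_{i\in I}\mid\delta_{v,w}$; $\pi::=\alpha\mid v.\pi\mid[t]\pi$; $p::=t\ast\pi$; $I$ finite; $\lambda x$, $\mu\alpha$ and the $x_i$ in case branches are binders, term variables are never bound. Substitutions map $\lambda$-variables to values, stack variables to stacks, term variables to terms (capture-avoiding). $\succ$ is the smallest relation on processes with: $t\,u\ast\pi\succ u\ast[t]\pi$; $v\ast[t]\pi\succ t\ast v.\pi$; $\lambda x\,t\ast v.\pi\succ t[x:=v]\ast\pi$; $\mu\alpha\,t\ast\pi\succ t[\alpha:=\pi]\ast\pi$; $p\ast\pi\succ p$; $\{l_i=v_i\}_{i\in I}.l_k\ast\pi\succ v_k\ast\pi$ ($k\in I$); $\mathrm{case}_{C_k[v]}[C_i[x_i]\to t_i]_{i\in I}\ast\pi\succ t_k[x_k:=v]\ast\pi$ ($k\in I$). A process is final if it is $v\ast\alpha$ with $v$ a value and $\alpha$ a stack variable; for a relation $R$, $p\Downarrow_R$ means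 $p\,R^*\,q$ with $q$ final. For $i\in\mathbb N$, inductively: $\rightsquigarrow_i=\succ\cup\{(\delta_{v,w}\ast\pi,v\ast\pi)\mid\exists j<i,\ v\not\equiv_jw\}$; $t\equiv_iu$ iff for all $j\le i$, stacks $\pi$, substitutions $\sigma$: $t\sigma\ast\pi\Downarrow_{\rightsquigarrow_j}\Leftrightarrow u\sigma\ast\pi\Downarrow_{\rightsquigarrow_j}$; $\not\equiv_i$ is its negation. $\equiv=\bigcap_i\equiv_i$. *)

theory Defs
  imports "HOL-Library.Finite_Map" "HOL-Library.Countable"
begin

text \<open>
  The syntax is taken modulo alpha-equivalence by means of de Bruijn indices. There are two
  independent index spaces, one for \<open>\<lambda>\<close>-variables and one for stack variables; an index
  exceeding the number of enclosing binders of its kind denotes a free variable. Term variables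
  are never bound and are therefore plain names. A family indexed by a finite set, with pairwise
  distinct labels or constructors, is a finite map.
\<close>

datatype (dead 'l, dead 'c) val =
    LVar nat
  | Lam "('l, 'c) trm"  \<comment> \<open>binds \<open>\<lambda>\<close>-variable 0\<close>
  | Con 'c "('l, 'c) val"
  | Rcd "('l, ('l, 'c) val) fmap"
and ('l, 'c) trm =
    TVar nat
  | Val "('l, 'c) val"
  | App "('l, 'c) trm" "('l, 'c) trm"
  | Mu "('l, 'c) trm"  \<comment> \<open>binds stack variable 0\<close>
  | Prc "('l, 'c) prc"
  | Proj "('l, 'c) val" 'l
  | Case "('l, 'c) val" "('c, ('l, 'c) trm) fmap"  \<comment> \<open>each branch binds \<open>\<lambda>\<close>-variable 0\<close>
  | Delta "('l, 'c) val" "('l, 'c) val"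
and ('l, 'c) stk =
    SVar nat
  | Push "('l, 'c) val" "('l, 'c) stk"  \<comment> \<open>\<open>v.\<pi>\<close>\<close>
  | Frame "('l, 'c) trm" "('l, 'c) stk"  \<comment> \<open>\<open>[t]\<pi>\<close>\<close>
and ('l, 'c) prc =
    Cmd "('l, 'c) trm" "('l, 'c) stk"  (infix \<open>\<star>\<close> 60)

definition lift_ren :: "(nat \<Rightarrow> nat) \<Rightarrow> nat \<Rightarrow> nat" where
  "lift_ren r = case_nat 0 (\<lambda>n. Suc (r n))"

text \<open>Renaming of \<open>\<lambda>\<close>-variables by \<open>r\<close> and of stack variables by \<open>s\<close>.\<close>

primrec
  ren_val :: "(nat \<Rightarrow> nat) \<Rightarrow> (nat \<Rightarrow> nat) \<Rightarrow> ('l, 'c) val \<Rightarrow> ('l, 'c) val" and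
  ren_trm :: "(nat \<Rightarrow> nat) \<Rightarrow> (nat \<Rightarrow> nat) \<Rightarrow> ('l, 'c) trm \<Rightarrow> ('l, 'c) trm" and
  ren_stk :: "(nat \<Rightarrow> nat) \<Rightarrow> (nat \<Rightarrow> nat) \<Rightarrow> ('l, 'c) stk \<Rightarrow> ('l, 'c) stk" and
  ren_prc :: "(nat \<Rightarrow> nat) \<Rightarrow> (nat \<Rightarrow> nat) \<Rightarrow> ('l, 'c) prc \<Rightarrow> ('l, 'c) prc"
where
  "ren_val r s (LVar n) = LVar (r n)"
| "ren_val r s (Lam t) = Lam (ren_trm (lift_ren r) s t)"
| "ren_val r s (Con c v) = Con c (ren_val r s v)"
| "ren_val r s (Rcd m) = Rcd (fmmap (\<lambda>v. ren_val r s v) m)"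
| "ren_trm r s (TVar a) = TVar a"
| "ren_trm r s (Val v) = Val (ren_val r s v)"
| "ren_trm r s (App t u) = App (ren_trm r s t) (ren_trm r s u)"
| "ren_trm r s (Mu t) = Mu (ren_trm r (lift_ren s) t)"
| "ren_trm r s (Prc p) = Prc (ren_prc r s p)"
| "ren_trm r s (Proj v l) = Proj (ren_val r s v) l"
| "ren_trm r s (Case v m) = Case (ren_val r s v) (fmmap (\<lambda>t. ren_trm (lift_ren r) s t) m)"
| "ren_trm r s (Delta v w) = Delta (ren_val r s v) (ren_val r s w)"
| "ren_stk r s (SVar n) = SVar (s n)"
| "ren_stk r s (Push v \<pi>) = Push (ren_val r s v) (ren_stk r s \<pi>)"
| "ren_stk r s (Frame t \<pi>) = Frame (ren_trm r s t) (ren_stk r s \<pi>)"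
| "ren_prc r s (t \<star> \<pi>) = ren_trm r s t \<star> ren_stk r s \<pi>"

text \<open>
  A substitution is a triple of total maps on \<open>\<lambda>\<close>-variables, stack variables and term variables.
  \<open>lift_lam\<close> and \<open>lift_mu\<close> push it under a binder of the respective kind; all three components
  must be shifted to avoid capture.
\<close>

type_synonym ('l, 'c) subst =
  "(nat \<Rightarrow> ('l, 'c) val) \<times> (nat \<Rightarrow> ('l, 'c) stk) \<times> (nat \<Rightarrow> ('l, 'c) trm)"

definition lift_lam :: "('l, 'c) subst \<Rightarrow> ('l, 'c) subst" where
  "lift_lam = (\<lambda>(f, g, h).
    (case_nat (LVar 0) (\<lambda>n. ren_val Suc id (f n)),
     \<lambda>n. ren_stk Suc id (g n),
     \<lambda>a. ren_trm Suc id (h a)))"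

definition lift_mu :: "('l, 'c) subst \<Rightarrow> ('l, 'c) subst" where
  "lift_mu = (\<lambda>(f, g, h).
    (\<lambda>n. ren_val id Suc (f n),
     case_nat (SVar 0) (\<lambda>n. ren_stk id Suc (g n)),
     \<lambda>a. ren_trm id Suc (h a)))"

primrec
  sub_val :: "('l, 'c) subst \<Rightarrow> ('l, 'c) val \<Rightarrow> ('l, 'c) val" and
  sub_trm :: "('l, 'c) subst \<Rightarrow> ('l, 'c) trm \<Rightarrow> ('l, 'c) trm" and
  sub_stk :: "('l, 'c) subst \<Rightarrow> ('l, 'c) stk \<Rightarrow> ('l, 'c) stk" and
  sub_prc :: "('l, 'c) subst \<Rightarrow> ('l, 'c) prc \<Rightarrow> ('l, 'c) prc"
where
  "sub_val \<sigma> (LVar n) = fst \<sigma> n"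
| "sub_val \<sigma> (Lam t) = Lam (sub_trm (lift_lam \<sigma>) t)"
| "sub_val \<sigma> (Con c v) = Con c (sub_val \<sigma> v)"
| "sub_val \<sigma> (Rcd m) = Rcd (fmmap (\<lambda>v. sub_val \<sigma> v) m)"
| "sub_trm \<sigma> (TVar a) = snd (snd \<sigma>) a"
| "sub_trm \<sigma> (Val v) = Val (sub_val \<sigma> v)"
| "sub_trm \<sigma> (App t u) = App (sub_trm \<sigma> t) (sub_trm \<sigma> u)"
| "sub_trm \<sigma> (Mu t) = Mu (sub_trm (lift_mu \<sigma>) t)"
| "sub_trm \<sigma> (Prc p) = Prc (sub_prc \<sigma> p)"
| "sub_trm \<sigma> (Proj v l) = Proj (sub_val \<sigma> v) l"
| "sub_trm \<sigma> (Case v m) = Case (sub_val \<sigma> v) (fmmap (\<lambda>t. sub_trm (lift_lam \<sigma>) t) m)"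
| "sub_trm \<sigma> (Delta v w) = Delta (sub_val \<sigma> v) (sub_val \<sigma> w)"
| "sub_stk \<sigma> (SVar n) = fst (snd \<sigma>) n"
| "sub_stk \<sigma> (Push v \<pi>) = Push (sub_val \<sigma> v) (sub_stk \<sigma> \<pi>)"
| "sub_stk \<sigma> (Frame t \<pi>) = Frame (sub_trm \<sigma> t) (sub_stk \<sigma> \<pi>)"
| "sub_prc \<sigma> (t \<star> \<pi>) = sub_trm \<sigma> t \<star> sub_stk \<sigma> \<pi>"

text \<open>
  \<open>inst_lam v t\<close> and \<open>inst_mu \<pi> t\<close> are \<open>t[x:=v]\<close> and \<open>t[\<alpha>:=\<pi>]\<close> for the body \<open>t\<close> of a removed
  binder, whose variable is index 0; the other free variables of that kind move down by one.
\<close>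

definition inst_lam :: "('l, 'c) val \<Rightarrow> ('l, 'c) trm \<Rightarrow> ('l, 'c) trm" where
  "inst_lam v = sub_trm (case_nat v LVar, SVar, TVar)"

definition inst_mu :: "('l, 'c) stk \<Rightarrow> ('l, 'c) trm \<Rightarrow> ('l, 'c) trm" where
  "inst_mu \<pi> = sub_trm (LVar, case_nat \<pi> SVar, TVar)"

definition subst_tvar :: "('l, 'c) trm \<Rightarrow> nat \<Rightarrow> ('l, 'c) trm \<Rightarrow> ('l, 'c) trm"
    (\<open>_[_ ::= _]\<close> [1000, 0, 0] 1000) where
  "E[a ::= t] = sub_trm (LVar, SVar, TVar(a := t)) E"

inductive red :: "('l, 'c) prc \<Rightarrow> ('l, 'c) prc \<Rightarrow> bool"  (infix \<open>\<succ>\<close> 50) where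
  red_app: "App t u \<star> \<pi> \<succ> u \<star> Frame t \<pi>"
| red_frame: "Val v \<star> Frame t \<pi> \<succ> t \<star> Push v \<pi>"
| red_lam: "Val (Lam t) \<star> Push v \<pi> \<succ> inst_lam v t \<star> \<pi>"
| red_mu: "Mu t \<star> \<pi> \<succ> inst_mu \<pi> t \<star> \<pi>"
| red_prc: "Prc p \<star> \<pi> \<succ> p"
| red_proj: "fmlookup m l = Some v \<Longrightarrow> Proj (Rcd m) l \<star> \<pi> \<succ> Val v \<star> \<pi>"
| red_case: "fmlookup m c = Some t \<Longrightarrow> Case (Con c v) m \<star> \<pi> \<succ> inst_lam v t \<star> \<pi>"

definition final :: "('l, 'c) prc \<Rightarrow> bool" where
  "final p \<longleftrightarrow> (\<exists>v n. p = Val v \<star> SVar n)"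

definition converges :: "(('l, 'c) prc \<Rightarrow> ('l, 'c) prc \<Rightarrow> bool) \<Rightarrow> ('l, 'c) prc \<Rightarrow> bool" where
  "converges R p \<longleftrightarrow> (\<exists>q. R\<^sup>*\<^sup>* p q \<and> final q)"

function
  step :: "nat \<Rightarrow> ('l, 'c) prc \<Rightarrow> ('l, 'c) prc \<Rightarrow> bool" and
  equiv_upto :: "nat \<Rightarrow> ('l, 'c) trm \<Rightarrow> ('l, 'c) trm \<Rightarrow> bool"
where
  "step i = (\<lambda>p q. p \<succ> q \<or>
    (\<exists>v w \<pi>. p = Delta v w \<star> \<pi> \<and> q = Val v \<star> \<pi> \<and>
      (\<exists>j\<in>{..<i}. \<not> equiv_upto j (Val v) (Val w))))"
| "equiv_upto i = (\<lambda>t u. \<forall>j\<in>{..i}. \<forall>\<pi> \<sigma>.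
    converges (step j) (sub_trm \<sigma> t \<star> \<pi>) \<longleftrightarrow> converges (step j) (sub_trm \<sigma> u \<star> \<pi>))"
  by pat_completeness auto
termination
  by (relation "measure (case_sum (\<lambda>i. 2 * i) (\<lambda>i. 2 * i + 1))") auto

declare step.simps [simp del] equiv_upto.simps [simp del]

definition obs_equiv :: "('l, 'c) trm \<Rightarrow> ('l, 'c) trm \<Rightarrow> bool"  (infix \<open>\<equiv>\<^sub>o\<close> 50) where
  "t \<equiv>\<^sub>o u \<longleftrightarrow> (\<forall>i. equiv_upto i t u)"

end

theory Submission
  imports Defs
begin

text \<open>
  Choose a fresh term variable, index 0 after shifting all others, to mark the occurrences of
  \<open>t1\<close> and \<open>t2\<close>. By induction on \<open>i\<close>, and then on the length of a reduction of the marked process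
  with \<open>t1\<close> filled in, filling in \<open>t2\<close> preserves convergence for \<open>step i\<close>. Reduction steps of a
  process not headed by the mark do not depend on the filling; for \<open>Delta\<close> steps this is the outer
  induction hypothesis. When the mark reaches the head, it is replaced by \<open>t1\<close> at the head only:
  the process is then headed by something else, and the assumed equivalence exchanges that copy
  of \<open>t1\<close> for \<open>t2\<close> after the other copies have been exchanged.
\<close>

section \<open>Substitution algebra\<close>

lemma lift_ren_comp: "lift_ren r \<circ> lift_ren r' = lift_ren (r \<circ> r')"
  by (auto simp: lift_ren_def fun_eq_iff split: nat.splits)

text \<open>First of four fusion laws. Lifting a substitution weakens its images by a renaming, so
  \<open>ren_ren\<close> is needed to lift \<open>ren_sub\<close>, and \<open>sub_ren\<close> with
  \<open>ren_sub\<close> to lift \<open>comp_sub\<close>.\<close>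

lemma ren_ren:
  fixes v :: "('l, 'c) val" and t :: "('l, 'c) trm" and \<pi> :: "('l, 'c) stk" and p :: "('l, 'c) prc"
  shows "ren_val r s (ren_val r' s' v) = ren_val (r \<circ> r') (s \<circ> s') v"
    and "ren_trm r s (ren_trm r' s' t) = ren_trm (r \<circ> r') (s \<circ> s') t"
    and "ren_stk r s (ren_stk r' s' \<pi>) = ren_stk (r \<circ> r') (s \<circ> s') \<pi>"
    and "ren_prc r s (ren_prc r' s' p) = ren_prc (r \<circ> r') (s \<circ> s') p"
  by (induction v and t and \<pi> and p arbitrary: r s r' s' and r s r' s' and r s r' s' and r s r' s')
    (simp_all add: lift_ren_comp[unfolded comp_def] fmap.map_comp comp_def cong: fmap.map_cong)

lemma lift_sel:
  "fst (lift_lam \<sigma>) n = (case n of 0 \<Rightarrow> LVar 0 | Suc m \<Rightarrow> ren_val Suc id (fst \<sigma> m))"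
  "fst (snd (lift_lam \<sigma>)) n = ren_stk Suc id (fst (snd \<sigma>) n)"
  "snd (snd (lift_lam \<sigma>)) n = ren_trm Suc id (snd (snd \<sigma>) n)"
  "fst (lift_mu \<sigma>) n = ren_val id Suc (fst \<sigma> n)"
  "fst (snd (lift_mu \<sigma>)) n = (case n of 0 \<Rightarrow> SVar 0 | Suc m \<Rightarrow> ren_stk id Suc (fst (snd \<sigma>) m))"
  "snd (snd (lift_mu \<sigma>)) n = ren_trm id Suc (snd (snd \<sigma>) n)"
  by (cases \<sigma>; cases n; simp add: lift_lam_def lift_mu_def)+

lemma subst_eqI:
  assumes "\<And>n. fst \<sigma> n = fst \<tau> n" and "\<And>n. fst (snd \<sigma>) n = fst (snd \<tau>) n"
    and "\<And>n. snd (snd \<sigma>) n = snd (snd \<tau>) n"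
  shows "\<sigma> = (\<tau> :: ('l, 'c) subst)"
  using assms by (simp add: prod_eq_iff fun_eq_iff)

definition comp_ren :: "('l, 'c) subst \<Rightarrow> (nat \<Rightarrow> nat) \<Rightarrow> (nat \<Rightarrow> nat) \<Rightarrow> ('l, 'c) subst" where
  "comp_ren \<sigma> r s = (fst \<sigma> \<circ> r, fst (snd \<sigma>) \<circ> s, snd (snd \<sigma>))"

lemma comp_ren_sel [simp]:
  "fst (comp_ren \<sigma> r s) n = fst \<sigma> (r n)"
  "fst (snd (comp_ren \<sigma> r s)) n = fst (snd \<sigma>) (s n)"
  "snd (snd (comp_ren \<sigma> r s)) n = snd (snd \<sigma>) n"
  by (simp_all add: comp_ren_def)

lemma comp_ren_lift:
  "comp_ren (lift_lam \<sigma>) (lift_ren r) s = lift_lam (comp_ren \<sigma> r s)"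
  "comp_ren (lift_mu \<sigma>) r (lift_ren s) = lift_mu (comp_ren \<sigma> r s)"
  by (rule subst_eqI; simp add: lift_sel lift_ren_def split: nat.splits)+

lemma sub_ren:
  fixes v :: "('l, 'c) val" and t :: "('l, 'c) trm" and \<pi> :: "('l, 'c) stk" and p :: "('l, 'c) prc"
  shows "sub_val \<sigma> (ren_val r s v) = sub_val (comp_ren \<sigma> r s) v"
    and "sub_trm \<sigma> (ren_trm r s t) = sub_trm (comp_ren \<sigma> r s) t"
    and "sub_stk \<sigma> (ren_stk r s \<pi>) = sub_stk (comp_ren \<sigma> r s) \<pi>"
    and "sub_prc \<sigma> (ren_prc r s p) = sub_prc (comp_ren \<sigma> r s) p"
  by (induction v and t and \<pi> and p arbitrary: \<sigma> r s and \<sigma> r s and \<sigma> r s and \<sigma> r s)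
    (simp_all add: comp_ren_lift fmap.map_comp comp_def cong: fmap.map_cong)

definition ren_sub :: "(nat \<Rightarrow> nat) \<Rightarrow> (nat \<Rightarrow> nat) \<Rightarrow> ('l, 'c) subst \<Rightarrow> ('l, 'c) subst" where
  "ren_sub r s \<sigma> = (ren_val r s \<circ> fst \<sigma>, ren_stk r s \<circ> fst (snd \<sigma>), ren_trm r s \<circ> snd (snd \<sigma>))"

lemma ren_sub_sel [simp]:
  "fst (ren_sub r s \<sigma>) n = ren_val r s (fst \<sigma> n)"
  "fst (snd (ren_sub r s \<sigma>)) n = ren_stk r s (fst (snd \<sigma>) n)"
  "snd (snd (ren_sub r s \<sigma>)) n = ren_trm r s (snd (snd \<sigma>) n)"
  by (simp_all add: ren_sub_def)

lemma ren_sub_lift: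
  "ren_sub (lift_ren r) s (lift_lam \<sigma>) = lift_lam (ren_sub r s \<sigma>)"
  "ren_sub r (lift_ren s) (lift_mu \<sigma>) = lift_mu (ren_sub r s \<sigma>)"
  by (rule subst_eqI; simp add: lift_sel lift_ren_def ren_ren comp_def split: nat.splits)+

lemma ren_sub:
  fixes v :: "('l, 'c) val" and t :: "('l, 'c) trm" and \<pi> :: "('l, 'c) stk" and p :: "('l, 'c) prc"
  shows "ren_val r s (sub_val \<sigma> v) = sub_val (ren_sub r s \<sigma>) v"
    and "ren_trm r s (sub_trm \<sigma> t) = sub_trm (ren_sub r s \<sigma>) t"
    and "ren_stk r s (sub_stk \<sigma> \<pi>) = sub_stk (ren_sub r s \<sigma>) \<pi>"
    and "ren_prc r s (sub_prc \<sigma> p) = sub_prc (ren_sub r s \<sigma>) p"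
  by (induction v and t and \<pi> and p arbitrary: \<sigma> r s and \<sigma> r s and \<sigma> r s and \<sigma> r s)
    (simp_all add: ren_sub_lift fmap.map_comp comp_def cong: fmap.map_cong)

definition comp_sub :: "('l, 'c) subst \<Rightarrow> ('l, 'c) subst \<Rightarrow> ('l, 'c) subst" where
  "comp_sub \<tau> \<sigma> = (sub_val \<tau> \<circ> fst \<sigma>, sub_stk \<tau> \<circ> fst (snd \<sigma>), sub_trm \<tau> \<circ> snd (snd \<sigma>))"

lemma comp_sub_sel [simp]:
  "fst (comp_sub \<tau> \<sigma>) n = sub_val \<tau> (fst \<sigma> n)"
  "fst (snd (comp_sub \<tau> \<sigma>)) n = sub_stk \<tau> (fst (snd \<sigma>) n)"
  "snd (snd (comp_sub \<tau> \<sigma>)) n = sub_trm \<tau> (snd (snd \<sigma>) n)"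
  by (simp_all add: comp_sub_def)

lemma comp_sub_lift:
  "comp_sub (lift_lam \<tau>) (lift_lam \<sigma>) = lift_lam (comp_sub \<tau> \<sigma>)"
  "comp_sub (lift_mu \<tau>) (lift_mu \<sigma>) = lift_mu (comp_sub \<tau> \<sigma>)"
proof -
  \<comment> \<open>Weakened images never mention the new index 0, so the lifted
    \<open>\<tau>\<close> acts on them as \<open>\<tau>\<close> followed by weakening.\<close>
  have "comp_ren (lift_lam \<tau>) Suc id = ren_sub Suc id \<tau>"
    and "comp_ren (lift_mu \<tau>) id Suc = ren_sub id Suc \<tau>"
    by (rule subst_eqI; simp add: lift_sel)+
  then show "comp_sub (lift_lam \<tau>) (lift_lam \<sigma>) = lift_lam (comp_sub \<tau> \<sigma>)"
    and "comp_sub (lift_mu \<tau>) (lift_mu \<sigma>) = lift_mu (comp_sub \<tau> \<sigma>)"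
    by (intro subst_eqI; simp add: lift_sel sub_ren ren_sub split: nat.splits)+
qed

lemma sub_sub:
  fixes v :: "('l, 'c) val" and t :: "('l, 'c) trm" and \<pi> :: "('l, 'c) stk" and p :: "('l, 'c) prc"
  shows "sub_val \<tau> (sub_val \<sigma> v) = sub_val (comp_sub \<tau> \<sigma>) v"
    and "sub_trm \<tau> (sub_trm \<sigma> t) = sub_trm (comp_sub \<tau> \<sigma>) t"
    and "sub_stk \<tau> (sub_stk \<sigma> \<pi>) = sub_stk (comp_sub \<tau> \<sigma>) \<pi>"
    and "sub_prc \<tau> (sub_prc \<sigma> p) = sub_prc (comp_sub \<tau> \<sigma>) p"
  by (induction v and t and \<pi> and p arbitrary: \<sigma> \<tau> and \<sigma> \<tau> and \<sigma> \<tau> and \<sigma> \<tau>)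
    (simp_all add: comp_sub_lift fmap.map_comp comp_def cong: fmap.map_cong)

definition id_sub :: "('l, 'c) subst" where
  "id_sub = (LVar, SVar, TVar)"

lemma id_sub_sel [simp]: "fst id_sub = LVar" "fst (snd id_sub) = SVar" "snd (snd id_sub) = TVar"
  by (simp_all add: id_sub_def)

lemma lift_id_sub: "lift_lam id_sub = id_sub" "lift_mu id_sub = id_sub"
  by (rule subst_eqI; simp add: lift_sel split: nat.splits)+

lemma sub_id:
  fixes v :: "('l, 'c) val" and t :: "('l, 'c) trm" and \<pi> :: "('l, 'c) stk" and p :: "('l, 'c) prc"
  shows "sub_val id_sub v = v" and "sub_trm id_sub t = t"
    and "sub_stk id_sub \<pi> = \<pi>" and "sub_prc id_sub p = p"
  by (induction v and t and \<pi> and p) (simp_all add: lift_id_sub fmap.map_ident cong: fmap.map_cong)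

lemma sub_inst_lam:
  "sub_trm \<sigma> (inst_lam v t) = inst_lam (sub_val \<sigma> v) (sub_trm (lift_lam \<sigma>) t)"
proof -
  \<comment> \<open>Instantiating index 0 undoes the weakening that \<open>lift_lam\<close> applies
    to the images of \<open>\<sigma>\<close>.\<close>
  have "comp_ren (case_nat w LVar, SVar, TVar) Suc id = id_sub" for w :: "('a, 'b) val"
    by (auto simp: comp_ren_def id_sub_def)
  then show ?thesis
    by (auto simp: inst_lam_def sub_sub lift_sel sub_ren sub_id
        intro!: subst_eqI arg_cong[where f = "\<lambda>\<tau>. sub_trm \<tau> t"] split: nat.splits)
qed

lemma sub_inst_mu:
  "sub_trm \<sigma> (inst_mu \<pi> t) = inst_mu (sub_stk \<sigma> \<pi>) (sub_trm (lift_mu \<sigma>) t)"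
proof -
  have "comp_ren (LVar, case_nat \<rho> SVar, TVar) id Suc = id_sub" for \<rho> :: "('a, 'b) stk"
    by (auto simp: comp_ren_def id_sub_def)
  then show ?thesis
    by (auto simp: inst_mu_def sub_sub lift_sel sub_ren sub_id
        intro!: subst_eqI arg_cong[where f = "\<lambda>\<tau>. sub_trm \<tau> t"] split: nat.splits)
qed

section \<open>Filling a fresh term variable\<close>

definition fill :: "('l, 'c) trm \<Rightarrow> ('l, 'c) subst" where
  "fill t = (LVar, SVar, case_nat t TVar)"

definition shift :: "('l, 'c) subst" where
  "shift = (LVar, SVar, \<lambda>a. TVar (Suc a))"

lemma comp_fill_shift: "comp_sub (fill t) shift = id_sub"
  by (auto simp: comp_sub_def fill_def shift_def id_sub_def fun_eq_iff)

lemma sub_fill_shift [simp]: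
  "sub_val (fill t) (sub_val shift v) = v" "sub_trm (fill t) (sub_trm shift u) = u"
  "sub_stk (fill t) (sub_stk shift \<pi>) = \<pi>" "sub_prc (fill t) (sub_prc shift p) = p"
  by (simp_all add: sub_sub comp_fill_shift sub_id)

text \<open>Ensures that a copy of \<open>t1\<close> exposed at the head is not the mark again, even
  if \<open>t1\<close> is itself a term variable.\<close>

lemma sub_shift_neq_mark: "sub_trm shift t \<noteq> TVar 0"
  by (cases t) (auto simp: shift_def)

text \<open>Composing with \<open>shift\<close> keeps the mark fresh for the substitution even though a
  substitution may mention every term variable.\<close>

lemma sub_update_eq_fill:
  "sub_trm (f, g, h(a := u)) E =
     sub_trm (fill u) (sub_trm (sub_val shift \<circ> f, sub_stk shift \<circ> g, (sub_trm shift \<circ> h)(a := TVar 0)) E)"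
  unfolding sub_sub
  by (rule arg_cong[where f = "\<lambda>\<tau>. sub_trm \<tau> E"])
    (auto simp: comp_sub_def fun_eq_iff, auto simp: fill_def)

text \<open>Absorbs the substitution quantified in \<open>equiv_upto\<close>. The marked term
  \<open>E'\<close> is chosen before \<open>t\<close>, so it serves both fillings.\<close>

lemma sub_sub_fill:
  "\<exists>E'. \<forall>t. sub_trm \<sigma> (sub_trm (fill t) E) = sub_trm (fill (sub_trm \<sigma> t)) E'"
proof -
  obtain f g h where \<sigma>: "\<sigma> = (f, g, h)"
    by (cases \<sigma>)
  \<comment> \<open>The value \<open>undefined\<close> at index 0 is only a placeholder, overwritten
    by the update.\<close>
  have "comp_sub \<sigma> (fill t) = (f, g, (case_nat undefined h)(0 := sub_trm \<sigma> t))" for t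
    by (auto simp: \<sigma> comp_sub_def fill_def fun_eq_iff split: nat.splits)
  then show ?thesis
    by (metis sub_sub(2) sub_update_eq_fill[of f g "case_nat undefined h" 0])
qed

section \<open>Reduction and substitution\<close>

lemma red_sub: "p \<succ> q \<Longrightarrow> sub_prc \<sigma> p \<succ> sub_prc \<sigma> q"
  by (induction rule: red.induct) (auto simp: sub_inst_lam sub_inst_mu intro: red.intros)

text \<open>Only term variables are replaced, so values, stacks and every head other than a term
  variable keep their outermost constructor: the redex is already visible before
  substitution.\<close>

lemma red_sub_reflect:
  assumes "sub_prc (LVar, SVar, h) (t \<star> \<pi>) \<succ> q" and "\<And>a. t \<noteq> TVar a"
  shows "\<exists>p'. q = sub_prc (LVar, SVar, h) p' \<and> t \<star> \<pi> \<succ> p'"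
proof (cases t)
  case (TVar a)
  then show ?thesis using assms by auto
next
  case (Val v)
  then show ?thesis using assms
    by (cases v; cases \<pi>) (auto elim!: red.cases simp flip: sub_inst_lam
      intro!: exI[of _ "_ \<star> _"] red.intros)
next
  case (App u1 u2)
  then show ?thesis using assms
    by (auto elim!: red.cases intro!: exI[of _ "u2 \<star> Frame u1 \<pi>"] red.intros)
next
  case (Mu u)
  then show ?thesis using assms
    by (auto elim!: red.cases intro!: exI[of _ "inst_mu \<pi> u \<star> \<pi>"] red.intros simp: sub_inst_mu)
next
  case (Prc p)
  then show ?thesis using assms
    by (auto elim!: red.cases intro!: red.intros)
next
  case (Proj v l)
  show ?thesis
  proof (cases v)
    case (Rcd m)
    with Proj assms obtain w where "fmlookup m l = Some w"
      and "q = sub_prc (LVar, SVar, h) (Val w \<star> \<pi>)"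
      by (auto elim!: red.cases)
    then show ?thesis
      using Proj Rcd by (blast intro: red.intros)
  qed (use Proj assms in \<open>auto elim!: red.cases\<close>)
next
  case (Case v m)
  show ?thesis
  proof (cases v)
    case (Con c w)
    with Case assms obtain u where "fmlookup m c = Some u"
      and "q = sub_prc (LVar, SVar, h) (inst_lam w u \<star> \<pi>)"
      by (auto elim!: red.cases simp: sub_inst_lam)
    then show ?thesis
      using Case Con by (blast intro: red.intros)
  qed (use Case assms in \<open>auto elim!: red.cases\<close>)
next
  case (Delta v w)
  then show ?thesis using assms by (auto elim!: red.cases)
qed

section \<open>Observational equivalence\<close>

lemma step_iff:
  "step i p q \<longleftrightarrow> p \<succ> q \<or>
    (\<exists>v w \<pi>. p = Delta v w \<star> \<pi> \<and> q = Val v \<star> \<pi> \<and> (\<exists>j<i. \<not> equiv_upto j (Val v) (Val w)))"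
  by (subst step.simps) auto

lemma equiv_upto_iff:
  "equiv_upto i t u \<longleftrightarrow> (\<forall>j\<le>i. \<forall>\<pi> \<sigma>.
    converges (step j) (sub_trm \<sigma> t \<star> \<pi>) \<longleftrightarrow> converges (step j) (sub_trm \<sigma> u \<star> \<pi>))"
  by (subst equiv_upto.simps) auto

lemma equiv_upto_sym: "equiv_upto i t u \<Longrightarrow> equiv_upto i u t"
  by (simp add: equiv_upto_iff)

lemma equiv_upto_trans: "equiv_upto i t u \<Longrightarrow> equiv_upto i u s \<Longrightarrow> equiv_upto i t s"
  by (simp add: equiv_upto_iff)

lemma equiv_upto_mono: "equiv_upto i t u \<Longrightarrow> j \<le> i \<Longrightarrow> equiv_upto j t u"
  by (simp add: equiv_upto_iff)

lemma equiv_upto_sub: "equiv_upto i t u \<Longrightarrow> equiv_upto i (sub_trm \<sigma> t) (sub_trm \<sigma> u)"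
  unfolding equiv_upto_iff sub_sub by blast

lemma equiv_upto_converges:
  "equiv_upto i t u \<Longrightarrow> converges (step i) (t \<star> \<pi>) \<Longrightarrow> converges (step i) (u \<star> \<pi>)"
  using sub_id(2)[of t] sub_id(2)[of u] unfolding equiv_upto_iff by (metis order_refl)

lemma converges_step: "R p q \<Longrightarrow> converges R q \<Longrightarrow> converges R p"
  by (auto simp: converges_def intro: converse_rtranclp_into_rtranclp)

lemma step_fill_transfer:
  assumes eq: "\<And>j v. j < i \<Longrightarrow> equiv_upto j (sub_trm (fill t1) v) (sub_trm (fill t2) v)"
    and step: "step i (sub_prc (fill t1) (t \<star> \<pi>)) q" and t: "t \<noteq> TVar 0"
  shows "\<exists>p'. q = sub_prc (fill t1) p' \<and> step i (sub_prc (fill t2) (t \<star> \<pi>)) (sub_prc (fill t2) p')"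
proof (cases t)
  case (TVar a)
  then obtain b where "t = TVar (Suc b)"
    using t by (cases a) auto
  then show ?thesis
    \<comment> \<open>A term variable other than the mark stays a term variable after filling, and
      such a head is stuck.\<close>
    using step by (auto simp: step_iff fill_def elim: red.cases)
next
  case (Delta v w)
  then obtain j where j: "j < i" "q = sub_prc (fill t1) (Val v \<star> \<pi>)"
      "\<not> equiv_upto j (sub_trm (fill t1) (Val v)) (sub_trm (fill t1) (Val w))"
    using step by (auto simp: step_iff elim: red.cases)
  \<comment> \<open>By \<open>eq\<close> the two fillings of \<open>v\<close> are equivalent at
    level \<open>j\<close>, and likewise those of \<open>w\<close>; equivalence of the
    \<open>t2\<close> fillings would thus force it for \<open>t1\<close>.\<close>
  then have "\<not> equiv_upto j (sub_trm (fill t2) (Val v)) (sub_trm (fill t2) (Val w))"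
    using eq[OF j(1)] equiv_upto_sym equiv_upto_trans by metis
  then show ?thesis
    using j Delta by (intro exI[of _ "Val v \<star> \<pi>"]) (auto simp: step_iff)
qed (use step red_sub_reflect[of "case_nat t1 TVar" t \<pi> q] red_sub[of "t \<star> \<pi>" _ "fill t2"] in
    \<open>auto simp: step_iff fill_def\<close>)

lemma final_fill_transfer:
  assumes "final (sub_prc (fill t1) (t \<star> \<pi>))" and "t \<noteq> TVar 0"
  shows "final (sub_prc (fill t2) (t \<star> \<pi>))"
proof -
  have "\<exists>v. t = Val v"
    using assms by (cases t) (auto simp: final_def fill_def split: nat.splits)
  moreover have "\<exists>n. \<pi> = SVar n"
    using assms by (cases \<pi>) (auto simp: final_def)
  ultimately show ?thesis
    by (auto simp: final_def fill_def)
qed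

lemma converges_fill:
  assumes eq: "\<And>j v. j < i \<Longrightarrow> equiv_upto j (sub_trm (fill t1) v) (sub_trm (fill t2) v)"
    and t12: "equiv_upto i t1 t2"
    and conv: "converges (step i) (sub_prc (fill t1) p)"
  shows "converges (step i) (sub_prc (fill t2) p)"
proof -
  obtain n q where "(step i ^^ n) (sub_prc (fill t1) p) q" "final q"
    using conv by (auto simp: converges_def rtranclp_power)
  then show ?thesis
  proof (induction n arbitrary: p rule: less_induct)
    case (less n)
    \<comment> \<open>Kept at length \<open>n\<close>: exposing \<open>t1\<close> at the head costs
      no step, so the induction hypothesis becomes available only after the next one.\<close>
    have unmarked: "converges (step i) (sub_prc (fill t2) (t \<star> \<pi>))"
      if t: "t \<noteq> TVar 0" and run: "(step i ^^ n) (sub_prc (fill t1) (t \<star> \<pi>)) q" for t \<pi>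
    proof (cases n)
      case 0
      then show ?thesis
        using run less.prems(2) final_fill_transfer[OF _ t] by (auto simp: converges_def)
    next
      case (Suc m)
      then obtain r where r: "step i (sub_prc (fill t1) (t \<star> \<pi>)) r" "(step i ^^ m) r q"
        using run by (metis relpowp_Suc_E2)
      obtain p' where p': "r = sub_prc (fill t1) p'"
          "step i (sub_prc (fill t2) (t \<star> \<pi>)) (sub_prc (fill t2) p')"
        using step_fill_transfer[OF eq r(1) t] by blast
      have "converges (step i) (sub_prc (fill t2) p')"
        using less.IH[of m p'] Suc r(2) p'(1) less.prems(2) by simp
      then show ?thesis
        using p'(2) by (rule converges_step[rotated])
    qed
    obtain t \<pi> where p: "p = t \<star> \<pi>"
      by (cases p)
    show ?case
    proof (cases "t = TVar 0")
      case True
      \<comment> \<open>Filling with \<open>t1\<close> gives the same process whether the head copy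
        is marked or written out; only a filling with \<open>t2\<close> tells them apart.\<close>
      then have "sub_prc (fill t1) p = sub_prc (fill t1) (sub_trm shift t1 \<star> \<pi>)"
        using p by (simp, simp add: fill_def)
      then have "converges (step i) (sub_prc (fill t2) (sub_trm shift t1 \<star> \<pi>))"
        using unmarked sub_shift_neq_mark less.prems(1) by metis
      \<comment> \<open>The marks in \<open>\<pi>\<close> now hold \<open>t2\<close>, while the head
        is still \<open>t1\<close>; \<open>t12\<close> exchanges it.\<close>
      then have "converges (step i) (t2 \<star> sub_stk (fill t2) \<pi>)"
        using equiv_upto_converges[OF t12] by simp
      moreover have "sub_trm (fill t2) t = t2"
        using True by (simp add: fill_def)
      ultimately show ?thesis
        using p by simp
    next
      case False
      then show ?thesis
        using unmarked less.prems(1) p by blast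
    qed
  qed
qed

lemma equiv_upto_fill:
  assumes "equiv_upto i t1 t2"
  shows "equiv_upto i (sub_trm (fill t1) E) (sub_trm (fill t2) E)"
  using assms
\<comment> \<open>Generalised because the hypothesis at lower levels is applied to the instances
  under \<open>\<sigma>\<close> and to arbitrary marked terms.\<close>
proof (induction i arbitrary: t1 t2 E rule: less_induct)
  case (less i)
  \<comment> \<open>Stated for arbitrary \<open>u1\<close> and \<open>u2\<close>, so that symmetry
    yields both directions.\<close>
  have conv: "converges (step j) (sub_trm \<sigma> (sub_trm (fill u2) E) \<star> \<pi>)"
    if "j \<le> i" and u: "equiv_upto i u1 u2"
      and c: "converges (step j) (sub_trm \<sigma> (sub_trm (fill u1) E) \<star> \<pi>)" for j \<sigma> \<pi> u1 u2
  proof -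
    obtain E' where E': "\<And>t. sub_trm \<sigma> (sub_trm (fill t) E) = sub_trm (fill (sub_trm \<sigma> t)) E'"
      using sub_sub_fill by metis
    have eq: "equiv_upto k (sub_trm \<sigma> u1) (sub_trm \<sigma> u2)" if "k \<le> j" for k
      using u \<open>j \<le> i\<close> that by (intro equiv_upto_sub) (auto intro: equiv_upto_mono)
    \<comment> \<open>Shifting \<open>\<pi>\<close> keeps it free of marks, so filling returns it
      unchanged.\<close>
    have "converges (step j) (sub_prc (fill (sub_trm \<sigma> u2)) (E' \<star> sub_stk shift \<pi>))"
    proof (rule converges_fill)
      show "equiv_upto j (sub_trm \<sigma> u1) (sub_trm \<sigma> u2)"
        by (simp add: eq)
      show "converges (step j) (sub_prc (fill (sub_trm \<sigma> u1)) (E' \<star> sub_stk shift \<pi>))"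
        using c by (simp add: E')
      show "equiv_upto k (sub_trm (fill (sub_trm \<sigma> u1)) v) (sub_trm (fill (sub_trm \<sigma> u2)) v)"
        if "k < j" for k v
        using less.IH[of k] eq[of k] that \<open>j \<le> i\<close> by simp
    qed
    then show ?thesis
      by (simp add: E')
  qed
  show ?case
    unfolding equiv_upto_iff
    using conv less.prems equiv_upto_sym[OF less.prems] by blast
qed

theorem theorem3:
  fixes t1 t2 E :: "('l::countable, 'c::countable) trm"
    and a :: nat
  assumes "t1 \<equiv>\<^sub>o t2"
  shows "E[a ::= t1] \<equiv>\<^sub>o E[a ::= t2]"
  using assms equiv_upto_fill
  \<comment> \<open>Both sides become fillings of one marked copy of \<open>E\<close>, with the mark
    in place of \<open>a\<close>; the claim then holds level by level.\<close>
  unfolding obs_equiv_def subst_tvar_def sub_update_eq_fill[of LVar SVar TVar a] by blast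

end
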